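(* Let $G$ be a countable discrete infinite amenable group, let $(X,G)$ be a $G$-system and let $U$ and $V$ be non-empty open subsets of $X$. If $(X,G)$ is minimal and topological $K$ then there exist $l\in\mathbb{N}$ and $g_1,\dots,g_l\in G$ such that $\bigcup_{i=1}^lg_iN(U,V)g_i^{-1}\subseteq G$ is cofinite (i.e. has finite complement in $G$). In particular, if $G$ is commutative then $(X,G)$ (minimal and topological $K$) is strongly mixing.
   Context: Let $F(G)$ be the set of non-empty finite subsets of $G$. A sequence $\{F_n\}_{n\in\mathbb{N}}\subseteq F(G)$ is a Følner sequence if for all $K\in F(G)$ and $\delta>0$ one has $|K^{-1}F_n\cap K^{-1}(G\setminus F_n)|<\delta|F_n|$ for all large $n$. A $G$-system $(X,G)$ is a compact metric space $X$ with a continuous action $G\times X\to X$. It is minimal if it has no proper non-empty compact $G$-invariant subset. For a finite cover $\mathcal{U}$ of $X$ and $F\in F(G)$, $\mathcal{U}_F=\bigvee_{g\in F}g^{-1}\mathcal{U}$ (the family of intersections); $N(\mathcal{U})$ is the minimal cardinality of a subfamily of $\mathcal{U}$ covering $X$; $h_{\text{top}}(G,\mathcal{U})=\lim_{n\to+\infty}\frac{1}{|F_n|}\log N(\mathcal{U}_{F_n})$, the limit existing and being independent of the Følner sequence. $(X,G)$ is (has) topological $K$ if every cover $\mathcal{U}$ of $X$ by finitely many non-dense open sets has $h_{\text{top}}(G,\mathcal{U})>0$. For non-empty open $U,V\subseteq X$, $N(U,V)=\{g\in G:U\cap g^{-1}V\ne\emptyset\}$. $(X,G)$ is strongly mixing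 if $N(U,V)$ is cofinite in $G$ for every pair of non-empty open sets $U,V$. *)

theory Defs
  imports "HOL-Analysis.Analysis" "HOL-Algebra.Group_Action"
begin

section \<open>Countable amenable groups\<close>

definition fin_subsets :: "('g, 'm) monoid_scheme \<Rightarrow> 'g set set" where
  "fin_subsets G = {K. K \<subseteq> carrier G \<and> finite K \<and> K \<noteq> {}}"

definition folner_seq :: "('g, 'm) monoid_scheme \<Rightarrow> (nat \<Rightarrow> 'g set) \<Rightarrow> bool" where
  "folner_seq G F \<longleftrightarrow>
     (\<forall>n. F n \<in> fin_subsets G) \<and>
     (\<forall>K\<in>fin_subsets G. \<forall>\<delta>>0. \<forall>\<^sub>F n in sequentially.
        real (card ((set_inv\<^bsub>G\<^esub> K <#>\<^bsub>G\<^esub> F n) \<inter> (set_inv\<^bsub>G\<^esub> K <#>\<^bsub>G\<^esub> (carrier G - F n))))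
          < \<delta> * real (card (F n)))"

text \<open>For countable discrete groups, amenability is the existence of a Folner sequence.\<close>

definition amenable :: "('g, 'm) monoid_scheme \<Rightarrow> bool" where
  "amenable G \<longleftrightarrow> (\<exists>F. folner_seq G F)"


section \<open>Systems over a discrete group\<close>

text \<open>The space $X$ is the universe of the type \<open>'x\<close>. Joint continuity of the action
  is with respect to the discrete topology on \<open>G\<close>.\<close>

definition G_system ::
    "('g, 'm) monoid_scheme \<Rightarrow> ('g \<Rightarrow> 'x::metric_space \<Rightarrow> 'x) \<Rightarrow> bool" where
  "G_system G act \<longleftrightarrow>
     compact (UNIV :: 'x set) \<and>
     group_action G UNIV act \<and>
     continuous_map (prod_topology (discrete_topology (carrier G)) euclidean) euclidean
       (\<lambda>(g, x). act g x)"

definition minimal_system ::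
    "('g, 'm) monoid_scheme \<Rightarrow> ('g \<Rightarrow> 'x::metric_space \<Rightarrow> 'x) \<Rightarrow> bool" where
  "minimal_system G act \<longleftrightarrow>
     \<not> (\<exists>Y. Y \<noteq> UNIV \<and> Y \<noteq> {} \<and> compact Y \<and> (\<forall>g\<in>carrier G. act g ` Y \<subseteq> Y))"

definition hitting_set ::
    "('g, 'm) monoid_scheme \<Rightarrow> ('g \<Rightarrow> 'x \<Rightarrow> 'x) \<Rightarrow> 'x set \<Rightarrow> 'x set \<Rightarrow> 'g set" where
  "hitting_set G act U V = {g \<in> carrier G. U \<inter> act (inv\<^bsub>G\<^esub> g) ` V \<noteq> {}}"

definition strongly_mixing ::
    "('g, 'm) monoid_scheme \<Rightarrow> ('g \<Rightarrow> 'x::metric_space \<Rightarrow> 'x) \<Rightarrow> bool" where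
  "strongly_mixing G act \<longleftrightarrow>
     (\<forall>U V. open U \<and> U \<noteq> {} \<and> open V \<and> V \<noteq> {} \<longrightarrow>
        finite (carrier G - hitting_set G act U V))"


section \<open>Entropy of finite covers\<close>

definition finite_cover :: "'x set set \<Rightarrow> bool" where
  "finite_cover \<U> \<longleftrightarrow> finite \<U> \<and> \<Union>\<U> = UNIV"

definition cover_join :: "'i set \<Rightarrow> ('i \<Rightarrow> 'x set set) \<Rightarrow> 'x set set" where
  "cover_join I \<C> = {\<Inter>i\<in>I. A i | A. \<forall>i\<in>I. A i \<in> \<C> i}"

definition dyn_cover ::
    "('g, 'm) monoid_scheme \<Rightarrow> ('g \<Rightarrow> 'x \<Rightarrow> 'x) \<Rightarrow> 'x set set \<Rightarrow> 'g set \<Rightarrow> 'x set set" where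
  "dyn_cover G act \<U> F = cover_join F (\<lambda>g. (\<lambda>A. act (inv\<^bsub>G\<^esub> g) ` A) ` \<U>)"

definition cover_number :: "'x set set \<Rightarrow> nat" where
  "cover_number \<U> = (LEAST n. \<exists>\<V>\<subseteq>\<U>. finite_cover \<V> \<and> card \<V> = n)"

text \<open>\<open>has_h_top G act \<U> h\<close> says $h_{top}(G,\mathcal{U}) = h$. As with \<open>sums\<close>
  or \<open>has_integral\<close>, the value of the limit is rendered as a relation. For amenable \<open>G\<close>
  the limit exists and does not depend on the Folner sequence (Ornstein--Weiss), so
  exactly one \<open>h\<close> is related to each finite cover. Amenability must be assumed separately:
  for \<open>G\<close> without Folner sequences the relation holds vacuously.\<close>

definition has_h_top ::
    "('g, 'm) monoid_scheme \<Rightarrow> ('g \<Rightarrow> 'x \<Rightarrow> 'x) \<Rightarrow> 'x set set \<Rightarrow> real \<Rightarrow> bool" where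
  "has_h_top G act \<U> h \<longleftrightarrow>
     (\<forall>F. folner_seq G F \<longrightarrow>
        (\<lambda>n. ln (real (cover_number (dyn_cover G act \<U> (F n)))) / real (card (F n)))
          \<longlonglongrightarrow> h)"

definition topological_K ::
    "('g, 'm) monoid_scheme \<Rightarrow> ('g \<Rightarrow> 'x::metric_space \<Rightarrow> 'x) \<Rightarrow> bool" where
  "topological_K G act \<longleftrightarrow>
     (\<forall>\<U>. finite_cover \<U> \<and> (\<forall>A\<in>\<U>. open A \<and> closure A \<noteq> UNIV) \<longrightarrow>
        (\<exists>h>0. has_h_top G act \<U> h))"

end

theory Submission
  imports Defs
begin

text \<open>
  By minimality and compactness, finitely many translates \<open>g\<^sub>i U\<close> cover \<open>X\<close>; these \<open>g\<^sub>i\<close> are the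
  conjugators. Let \<open>S\<close> be the complement of \<open>\<Union>\<^sub>i g\<^sub>i N(U,V) g\<^sub>i\<inverse>\<close> and suppose that \<open>S\<close> is infinite.
  An element \<open>s\<close> of \<open>S\<close> maps \<open>g\<^sub>i U\<close> off \<open>g\<^sub>i V\<close>, for every \<open>i\<close>. Let \<open>W\<^sub>i\<close> be the complement of
  \<open>g\<^sub>i C\<close>, where \<open>C \<subseteq> V\<close> is a closed ball. The \<open>W\<^sub>i\<close> are open and not dense, and a point of \<open>g\<^sub>i U\<close>
  is sent into the \<^emph>\<open>same\<close> set \<open>W\<^sub>i\<close> by all elements of \<open>S\<close>. So the cover \<open>\<W> = {W\<^sub>i}\<close> has
  \<open>N(\<W>\<^sub>F) \<le> l\<close> for every finite \<open>F \<subseteq> S\<close>, however large.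

  Such a bound along an infinite set forces zero entropy, against topological \<open>K\<close>
  (\<open>entropy_nonpos_if_bounded_along_infinite_set\<close>). Translating on the right, \<open>N(\<W>\<^bsub>Fg\<^esub>) \<le> l\<close> for all
  \<open>g\<close>. A Folner set \<open>A\<close> is covered by at most \<open>|A| / k\<close> translates \<open>Fg\<close>, chosen greedily with more
  than \<open>k\<close> new points each, and a remainder \<open>R\<close> that meets every \<open>Fg\<close> in at most \<open>k\<close> points
  (\<open>greedy_translates\<close>). Double counting bounds \<open>|R|\<close> by \<open>k |F\<inverse>A| / |F|\<close>
  (\<open>card_le_by_translates\<close>), hence by \<open>2k |A| / |F|\<close> if \<open>A\<close> is invariant enough. So
  \<open>ln N(\<W>\<^sub>A) / |A|\<close> is at most a constant times \<open>1/k + 2k/|F|\<close>, which is small for \<open>k\<close>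
  large and \<open>|F|\<close> much larger.

  In a commutative group conjugation is trivial, so \<open>N(U,V)\<close> itself is cofinite.
\<close>

section \<open>Counting itineraries\<close>

text \<open>A set of the join \<open>\<W>\<^sub>A\<close> is given by a selection of a member of \<open>\<W>\<close> for each \<open>g \<in> A\<close>.
  Working with selections instead of the sets they define makes restriction, translation and
  merging of index sets operations on functions; the index sets need not be disjoint for
  merging.\<close>

definition itineraries_le ::
    "('g \<Rightarrow> 'x \<Rightarrow> 'x) \<Rightarrow> 'x set set \<Rightarrow> 'g set \<Rightarrow> nat \<Rightarrow> bool" where
  "itineraries_le act \<W> A n \<longleftrightarrow>
     (\<exists>T. finite T \<and> card T \<le> n \<and> (\<forall>s\<in>T. \<forall>g\<in>A. s g \<in> \<W>) \<and>
          (\<forall>x. \<exists>s\<in>T. \<forall>g\<in>A. act g x \<in> s g))"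

lemma itineraries_le_subset:
  assumes "itineraries_le act \<W> A n" "B \<subseteq> A"
  shows "itineraries_le act \<W> B n"
  using assms unfolding itineraries_le_def by (meson subsetD)

lemma itineraries_le_empty: "itineraries_le act \<W> {} 1"
  unfolding itineraries_le_def by (rule exI[of _ "{\<lambda>_. {}}"]) simp

lemma itineraries_le_Un:
  fixes act :: "'g \<Rightarrow> 'x \<Rightarrow> 'x"
  assumes "itineraries_le act \<W> A m" "itineraries_le act \<W> B n"
  shows "itineraries_le act \<W> (A \<union> B) (m * n)"
proof -
  obtain S where S: "finite S" "card S \<le> m" "\<forall>s\<in>S. \<forall>g\<in>A. s g \<in> \<W>"
      "\<forall>x. \<exists>s\<in>S. \<forall>g\<in>A. act g x \<in> s g"
    using assms(1) unfolding itineraries_le_def by blast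
  obtain T where T: "finite T" "card T \<le> n" "\<forall>t\<in>T. \<forall>g\<in>B. t g \<in> \<W>"
      "\<forall>x. \<exists>t\<in>T. \<forall>g\<in>B. act g x \<in> t g"
    using assms(2) unfolding itineraries_le_def by blast
  define merge where "merge = (\<lambda>(s :: 'g \<Rightarrow> 'x set, t) g. if g \<in> A then s g else t g)"
  have "card (merge ` (S \<times> T)) \<le> card S * card T"
    using card_image_le[of "S \<times> T" merge] S(1) T(1) by (simp add: card_cartesian_product)
  also have "\<dots> \<le> m * n" using S(2) T(2) by (rule mult_le_mono)
  finally have card: "card (merge ` (S \<times> T)) \<le> m * n" .
  have sel: "\<forall>u\<in>merge ` (S \<times> T). \<forall>g\<in>A \<union> B. u g \<in> \<W>"
    using S(3) T(3) by (auto simp: merge_def)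
  have cov: "\<exists>u\<in>merge ` (S \<times> T). \<forall>g\<in>A \<union> B. act g x \<in> u g" for x
  proof -
    obtain s where "s \<in> S" "\<forall>g\<in>A. act g x \<in> s g" using S(4) by blast
    moreover obtain t where "t \<in> T" "\<forall>g\<in>B. act g x \<in> t g" using T(4) by blast
    ultimately show ?thesis
      by (intro bexI[of _ "merge (s, t)"]) (auto simp: merge_def)
  qed
  show ?thesis
    unfolding itineraries_le_def using S(1) T(1) card sel cov
    by (intro exI[of _ "merge ` (S \<times> T)"]) auto
qed

lemma itineraries_le_power:
  assumes "finite_cover \<W>" "finite A"
  shows "itineraries_le act \<W> A (card \<W> ^ card A)"
  using assms(2)
proof induction
  case empty
  show ?case using itineraries_le_empty by simp
next
  case (insert a A)
  have "itineraries_le act \<W> {a} (card \<W>)"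
    unfolding itineraries_le_def
  proof (intro exI[of _ "(\<lambda>W _. W) ` \<W>"] conjI)
    show "\<forall>x. \<exists>s\<in>(\<lambda>W _. W) ` \<W>. \<forall>g\<in>{a}. act g x \<in> s g"
      using assms(1) unfolding finite_cover_def by auto
  qed (use assms(1) in \<open>auto simp: finite_cover_def intro: card_image_le\<close>)
  from itineraries_le_Un[OF this insert.IH] show ?case
    using insert.hyps by simp
qed

context group_action
begin

lemma itineraries_le_r_coset:
  assumes "E = UNIV" "itineraries_le \<phi> \<W> F n" "F \<subseteq> carrier G" "g \<in> carrier G"
  shows "itineraries_le \<phi> \<W> (F #> g) n"
proof -
  interpret group G by (rule group_hom.axioms(1)[OF group_hom])
  obtain T where T: "finite T" "card T \<le> n" "\<forall>s\<in>T. \<forall>g\<in>F. s g \<in> \<W>"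
      "\<forall>x. \<exists>s\<in>T. \<forall>g\<in>F. \<phi> g x \<in> s g"
    using assms(2) unfolding itineraries_le_def by blast
  define tr where "tr = (\<lambda>(s :: 'a \<Rightarrow> 'c set) d. s (d \<otimes> inv g))"
  have canc: "f \<otimes> g \<otimes> inv g = f" if "f \<in> F" for f
    using that assms(3,4) by (simp add: m_assoc subset_iff)
  have cov: "\<exists>s\<in>tr ` T. \<forall>d\<in>F #> g. \<phi> d x \<in> s d" for x
  proof -
    obtain s where s: "s \<in> T" "\<forall>f\<in>F. \<phi> f (\<phi> g x) \<in> s f" using T(4) by blast
    have "\<phi> (f \<otimes> g) x = \<phi> f (\<phi> g x)" if "f \<in> F" for f
      using composition_rule[of x f g] that assms by auto
    then show ?thesis
      using s by (intro bexI[of _ "tr s"]) (auto simp: tr_def r_coset_def canc)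
  qed
  have "card (tr ` T) \<le> n" using T(1,2) card_image_le le_trans by blast
  then show ?thesis
    unfolding itineraries_le_def using T(1,3) cov
    by (intro exI[of _ "tr ` T"]) (auto simp: tr_def r_coset_def canc)
qed

lemma image_inv_eq_vimage:
  assumes "E = UNIV" "g \<in> carrier G"
  shows "\<phi> (inv g) ` W = \<phi> g -` W"
proof -
  interpret group G by (rule group_hom.axioms(1)[OF group_hom])
  have l: "\<phi> (inv g) (\<phi> g x) = x" for x
    using orbit_sym_aux[of g x] assms by simp
  have r: "\<phi> g (\<phi> (inv g) x) = x" for x
    using orbit_sym_aux[of "inv g" x] assms by simp
  show ?thesis
  proof (intro equalityI subsetI)
    fix x assume "x \<in> \<phi> g -` W"
    then show "x \<in> \<phi> (inv g) ` W" using l[of x] by (metis imageI vimageE)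
  qed (auto simp: r)
qed

lemma cover_number_le_if_itineraries_le:
  assumes "E = UNIV" "itineraries_le \<phi> \<W> A n" "A \<subseteq> carrier G"
  shows "cover_number (dyn_cover G \<phi> \<W> A) \<le> n"
proof -
  obtain T where T: "finite T" "card T \<le> n" "\<forall>s\<in>T. \<forall>g\<in>A. s g \<in> \<W>"
      "\<forall>x. \<exists>s\<in>T. \<forall>g\<in>A. \<phi> g x \<in> s g"
    using assms(2) unfolding itineraries_le_def by blast
  define cell where "cell = (\<lambda>s. \<Inter>g\<in>A. \<phi> (inv g) ` s g)"
  have "cell ` T \<subseteq> dyn_cover G \<phi> \<W> A"
  proof
    fix D assume "D \<in> cell ` T"
    then obtain s where s: "s \<in> T" "D = cell s" by blast
    have "\<forall>g\<in>A. \<phi> (inv g) ` s g \<in> (\<lambda>W. \<phi> (inv g) ` W) ` \<W>"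
      using T(3) s(1) by simp
    then show "D \<in> dyn_cover G \<phi> \<W> A"
      unfolding dyn_cover_def cover_join_def cell_def s(2) mem_Collect_eq
      by (intro exI[of _ "\<lambda>g. \<phi> (inv g) ` s g"] conjI refl)
  qed
  moreover have "finite_cover (cell ` T)"
  proof -
    have "cell s = {x. \<forall>g\<in>A. \<phi> g x \<in> s g}" for s
      using image_inv_eq_vimage[OF assms(1)] assms(3) unfolding cell_def
      by (auto simp: subset_iff)
    then have "\<Union> (cell ` T) = UNIV" using T(4) by auto
    then show ?thesis using T(1) unfolding finite_cover_def by simp
  qed
  ultimately have "cover_number (dyn_cover G \<phi> \<W> A) \<le> card (cell ` T)"
    unfolding cover_number_def by (intro Least_le) blast
  also have "\<dots> \<le> n" using T(1,2) card_image_le le_trans by blast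
  finally show ?thesis .
qed

end

section \<open>Covering a Folner set by translates\<close>

context group
begin

text \<open>Double counting of the pairs \<open>(f, r) \<in> F \<times> R\<close>: each lies over exactly one translate \<open>Fg\<close>,
  namely the one with \<open>g = f\<inverse>r\<close>, in which \<open>r\<close> determines \<open>f\<close>.\<close>

lemma card_le_by_translates:
  assumes "finite F" "F \<subseteq> carrier G" "finite R" "R \<subseteq> carrier G"
    and few: "\<And>g. g \<in> carrier G \<Longrightarrow> card ((F #> g) \<inter> R) \<le> k"
  shows "card F * card R \<le> k * card (set_inv F <#> R)"
proof -
  define B where "B = set_inv F <#> R"
  have B: "finite B" "B \<subseteq> carrier G"
  proof -
    have "B = (\<lambda>(f, r). inv f \<otimes> r) ` (F \<times> R)"
      unfolding B_def set_mult_def SET_INV_def by auto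
    then show "finite B" "B \<subseteq> carrier G" using assms by auto
  qed
  define fib where "fib = (\<lambda>g. (\<lambda>r. (r \<otimes> inv g, r)) ` ((F #> g) \<inter> R))"
  have "F \<times> R \<subseteq> (\<Union>g\<in>B. fib g)"
  proof clarify
    fix f r assume fr: "f \<in> F" "r \<in> R"
    have c: "f \<in> carrier G" "r \<in> carrier G" using fr assms by auto
    have "inv f \<otimes> r \<in> B" using fr unfolding B_def set_mult_def SET_INV_def by blast
    moreover have "r = f \<otimes> (inv f \<otimes> r)" using c by (simp add: m_assoc[symmetric])
    then have "r \<in> F #> (inv f \<otimes> r)" using fr unfolding r_coset_def by blast
    moreover have "r \<otimes> inv (inv f \<otimes> r) = f"
      using c by (simp add: inv_mult_group m_assoc[symmetric])
    ultimately show "(f, r) \<in> (\<Union>g\<in>B. fib g)"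
      unfolding fib_def using fr by (intro UN_I[of "inv f \<otimes> r"] image_eqI[of _ _ r]) simp_all
  qed
  moreover have "finite (\<Union>g\<in>B. fib g)"
    using B assms(3) unfolding fib_def by auto
  ultimately have "card (F \<times> R) \<le> card (\<Union>g\<in>B. fib g)" by (rule card_mono[rotated])
  also have "\<dots> \<le> (\<Sum>g\<in>B. card (fib g))" using B(1) by (rule card_UN_le)
  also have "\<dots> \<le> (\<Sum>g\<in>B. k)"
  proof (rule sum_mono)
    fix g assume "g \<in> B"
    then have "card ((F #> g) \<inter> R) \<le> k" using few B by auto
    moreover have "card (fib g) \<le> card ((F #> g) \<inter> R)"
      unfolding fib_def using assms(3) by (intro card_image_le) auto
    ultimately show "card (fib g) \<le> k" by linarith
  qed
  finally show ?thesis by (simp add: card_cartesian_product B_def mult.commute)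
qed

text \<open>With the identity adjoined to \<open>K\<close>, every point of \<open>K\<inverse>F\<^sub>n\<close> outside \<open>F\<^sub>n\<close> lies in the boundary
  that the Folner condition controls.\<close>

lemma folner_seq_card_le:
  assumes "folner_seq G F" "finite K" "K \<subseteq> carrier G"
  shows "\<forall>\<^sub>F n in sequentially. card (set_inv K <#> F n) \<le> 2 * card (F n)"
proof -
  define K' where "K' = insert \<one> K"
  have K': "K' \<in> fin_subsets G" using assms unfolding K'_def fin_subsets_def by auto
  define bd where
    "bd n = (set_inv K' <#> F n) \<inter> (set_inv K' <#> (carrier G - F n))" for n
  have "\<forall>\<^sub>F n in sequentially. real (card (bd n)) < 1 * real (card (F n))"
    using assms(1) K' zero_less_one unfolding folner_seq_def bd_def by blast
  then show ?thesis
  proof eventually_elim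
    case (elim n)
    have F: "F n \<subseteq> carrier G" "finite (F n)"
      using assms(1) unfolding folner_seq_def fin_subsets_def by auto
    have "set_inv K' <#> F n = (\<lambda>(f, r). inv f \<otimes> r) ` (K' \<times> F n)"
      unfolding set_mult_def SET_INV_def by auto
    then have fin: "finite (bd n)"
      using F K' unfolding bd_def fin_subsets_def by auto
    have "set_inv K <#> F n \<subseteq> F n \<union> bd n"
    proof
      fix x assume x: "x \<in> set_inv K <#> F n"
      have x': "x \<in> set_inv K' <#> F n"
        using x unfolding set_mult_def SET_INV_def K'_def by auto
      have xc: "x \<in> carrier G"
        using x F assms(3) unfolding set_mult_def SET_INV_def by auto
      have "x \<in> set_inv K' <#> (carrier G - F n)" if "x \<notin> F n"
      proof -
        have "\<one> \<in> set_inv K'" unfolding SET_INV_def K'_def by force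
        moreover have "x = \<one> \<otimes> x" using xc by simp
        ultimately show ?thesis using that xc unfolding set_mult_def by blast
      qed
      with x' show "x \<in> F n \<union> bd n" unfolding bd_def by blast
    qed
    then have "card (set_inv K <#> F n) \<le> card (F n \<union> bd n)"
      using F fin by (intro card_mono) auto
    also have "\<dots> \<le> card (F n) + card (bd n)" by (rule card_Un_le)
    finally show ?case using elim by linarith
  qed
qed

end

context group_action
begin

text \<open>Greedy choice: as long as some translate \<open>Fg\<close> contains more than \<open>k\<close> points of the set, remove
  them, at the price of a factor \<open>l\<close>. Each step uses up \<open>k\<close> points, so \<open>p\<close> steps need \<open>p k \<le> |A|\<close>.
  The points of the remainder are paid for one by one, with a factor \<open>|\<W>|\<close> each.\<close>

lemma greedy_translates:
  assumes "E = UNIV" "finite_cover \<W>" "F \<subseteq> carrier G" "itineraries_le \<phi> \<W> F l"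
    and "k > 0" "finite A"
  shows "\<exists>R p. R \<subseteq> A \<and> p * k \<le> card A \<and>
           (\<forall>g\<in>carrier G. card ((F #> g) \<inter> R) \<le> k) \<and>
           itineraries_le \<phi> \<W> A (l ^ p * card \<W> ^ card R)"
  using assms(6)
proof (induction "card A" arbitrary: A rule: less_induct)
  case less
  show ?case
  proof (cases "\<forall>g\<in>carrier G. card ((F #> g) \<inter> A) \<le> k")
    case True
    then show ?thesis
      using itineraries_le_power[OF assms(2) less.prems]
      by (intro exI[of _ A] exI[of _ 0]) auto
  next
    case False
    then obtain g where g: "g \<in> carrier G" "card ((F #> g) \<inter> A) > k" by force
    define D where "D = (F #> g) \<inter> A"
    have D: "D \<subseteq> A" "finite D" "card D > k"
      using g less.prems unfolding D_def by auto
    have cA: "card A = card D + card (A - D)"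
      using D less.prems by (simp add: card_Diff_subset card_mono)
    obtain R p where IH: "R \<subseteq> A - D" "p * k \<le> card (A - D)"
        "\<forall>g\<in>carrier G. card ((F #> g) \<inter> R) \<le> k"
        "itineraries_le \<phi> \<W> (A - D) (l ^ p * card \<W> ^ card R)"
      using less.hyps[of "A - D"] cA D less.prems by auto
    have "itineraries_le \<phi> \<W> D l"
      by (rule itineraries_le_subset[OF itineraries_le_r_coset[OF assms(1,4,3) g(1)]])
        (auto simp: D_def)
    from itineraries_le_Un[OF this IH(4)]
    have "itineraries_le \<phi> \<W> A (l ^ Suc p * card \<W> ^ card R)"
      using D(1) by (simp add: Un_absorb1 mult.assoc)
    moreover have "Suc p * k \<le> card A" using IH(2) cA D by simp
    ultimately show ?thesis
      using IH(1,3) by (intro exI[of _ R] exI[of _ "Suc p"]) blast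
  qed
qed

section \<open>Bounded complexity along an infinite set forces zero entropy\<close>

lemma ln_cover_number_le:
  fixes k l :: nat
  assumes "E = UNIV" "finite_cover \<W>" "F \<subseteq> carrier G" "finite F" "F \<noteq> {}"
    and "itineraries_le \<phi> \<W> F l" and "l > 0" "k > 0" "finite A" "A \<subseteq> carrier G"
    and inv: "card (set_inv F <#> A) \<le> 2 * card A"
  shows "ln (real (cover_number (dyn_cover G \<phi> \<W> A))) \<le>
           (ln l / k + 2 * k * ln (card \<W>) / card F) * card A"
proof -
  interpret group G by (rule group_hom.axioms(1)[OF group_hom])
  obtain R p where R: "R \<subseteq> A" "p * k \<le> card A"
      "\<forall>g\<in>carrier G. card ((F #> g) \<inter> R) \<le> k"
      "itineraries_le \<phi> \<W> A (l ^ p * card \<W> ^ card R)"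
    using greedy_translates[OF assms(1-3,6,8,9)] by blast
  have fR: "finite R" "R \<subseteq> carrier G" using R(1) assms(9,10) finite_subset by auto
  have "set_inv F <#> A = (\<lambda>(f, r). inv f \<otimes> r) ` (F \<times> A)"
    unfolding set_mult_def SET_INV_def by auto
  then have "finite (set_inv F <#> A)" using assms by auto
  moreover have "set_inv F <#> R \<subseteq> set_inv F <#> A"
    using R(1) unfolding set_mult_def by auto
  ultimately have "card (set_inv F <#> R) \<le> 2 * card A"
    using inv card_mono le_trans by blast
  moreover have "card F * card R \<le> k * card (set_inv F <#> R)"
    using card_le_by_translates assms(3,4) fR R(3) by blast
  ultimately have "card F * card R \<le> k * (2 * card A)"
    by (meson le_trans mult_le_mono2)
  then have "real (card F * card R) \<le> real (k * (2 * card A))" by (simp only: of_nat_le_iff)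
  moreover have Fpos: "card F > 0" using assms(4,5) by (simp add: card_gt_0_iff)
  ultimately have cR: "card R \<le> 2 * k / card F * card A"
    by (simp add: field_simps)
  have "real (p * k) \<le> real (card A)" using R(2) by (simp only: of_nat_le_iff)
  then have cp: "p \<le> card A / k"
    using assms(8) by (simp add: field_simps)
  have Wpos: "card \<W> > 0"
    using assms(2) unfolding finite_cover_def by (auto simp: card_gt_0_iff)
  define N where "N = cover_number (dyn_cover G \<phi> \<W> A)"
  have "N \<le> l ^ p * card \<W> ^ card R"
    unfolding N_def by (rule cover_number_le_if_itineraries_le[OF assms(1) R(4) assms(10)])
  then have N: "real N \<le> real l ^ p * real (card \<W>) ^ card R"
    by (metis of_nat_le_iff of_nat_mult of_nat_power)
  have lnl: "ln (real l) \<ge> 0" and lnW: "ln (real (card \<W>)) \<ge> 0"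
    using assms(7) Wpos by auto
  have "ln (real N) \<le> p * ln l + card R * ln (card \<W>)"
  proof (cases "N = 0")
    \<comment> \<open>Here the convention \<open>ln 0 = 0\<close> applies.\<close>
    case True
    then show ?thesis using lnl lnW by simp
  next
    case False
    then have "ln (real N) \<le> ln (real l ^ p * real (card \<W>) ^ card R)"
      using N by simp
    also have "\<dots> = p * ln l + card R * ln (card \<W>)"
      using assms(7) Wpos by (simp add: ln_mult ln_realpow)
    finally show ?thesis .
  qed
  also have "\<dots> \<le> card A / k * ln l + 2 * k / card F * card A * ln (card \<W>)"
    using cp cR lnl lnW by (intro add_mono mult_right_mono)
  also have "\<dots> = (ln l / k + 2 * k * ln (card \<W>) / card F) * card A"
    by (simp add: algebra_simps)
  finally show ?thesis unfolding N_def .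
qed

theorem entropy_nonpos_if_bounded_along_infinite_set:
  assumes "E = UNIV" "finite_cover \<W>" "amenable G" "has_h_top G \<phi> \<W> h"
    and "infinite S" "S \<subseteq> carrier G"
    and "\<And>F. finite F \<Longrightarrow> F \<subseteq> S \<Longrightarrow> itineraries_le \<phi> \<W> F l"
  shows "h \<le> 0"
proof (rule ccontr)
  assume "\<not> h \<le> 0"
  then have h: "h > 0" by simp
  interpret group G by (rule group_hom.axioms(1)[OF group_hom])
  have "itineraries_le \<phi> \<W> {} l" using assms(7) by blast
  then have l: "l > 0"
    unfolding itineraries_le_def by (metis card_gt_0_iff empty_iff not_gr0 le_zero_eq)
  \<comment> \<open>First \<open>k\<close> makes the translates cheap, then a set \<open>F\<close> that is large compared to \<open>k\<close> makes the
    remainder negligible; each contributes at most \<open>h/4\<close>.\<close>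
  obtain k :: nat where k: "4 * ln (real l) / h < k" using reals_Archimedean2 by blast
  moreover have "4 * ln (real l) / h \<ge> 0" using h l by simp
  ultimately have k0: "k > 0" by linarith
  obtain m :: nat where m: "8 * k * ln (real (card \<W>)) / h < m" using reals_Archimedean2 by blast
  obtain F where F: "finite F" "card F = Suc m" "F \<subseteq> S"
    using infinite_arbitrarily_large[OF assms(5)] by metis
  have Fc: "F \<subseteq> carrier G" "F \<noteq> {}" using F assms(6) by auto
  have "ln l / k \<le> h / 4" using k k0 h by (simp add: field_simps)
  moreover have "2 * k * ln (card \<W>) / card F \<le> h / 4"
    using m h F(2) by (simp add: field_simps)
  ultimately have small: "ln l / k + 2 * k * ln (card \<W>) / card F \<le> h / 2" by linarith
  obtain \<Phi> where \<Phi>: "folner_seq G \<Phi>" using assms(3) unfolding amenable_def by blast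
  define q where
    "q n = ln (real (cover_number (dyn_cover G \<phi> \<W> (\<Phi> n)))) / real (card (\<Phi> n))" for n
  have "q \<longlonglongrightarrow> h"
    using assms(4) \<Phi> unfolding has_h_top_def q_def by blast
  moreover have "\<forall>\<^sub>F n in sequentially. q n \<le> h / 2"
    using folner_seq_card_le[OF \<Phi> F(1) Fc(1)]
  proof eventually_elim
    case (elim n)
    have P: "\<Phi> n \<subseteq> carrier G" "finite (\<Phi> n)" "\<Phi> n \<noteq> {}"
      using \<Phi> unfolding folner_seq_def fin_subsets_def by auto
    then have pos: "card (\<Phi> n) > 0" by (simp add: card_gt_0_iff)
    have "ln (real (cover_number (dyn_cover G \<phi> \<W> (\<Phi> n)))) \<le>
        (ln l / k + 2 * k * ln (card \<W>) / card F) * card (\<Phi> n)"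
      using ln_cover_number_le[OF assms(1,2) Fc(1) F(1) Fc(2) assms(7)[OF F(1,3)] l k0 P(2,1) elim] .
    also have "\<dots> \<le> h / 2 * card (\<Phi> n)"
      using small by (intro mult_right_mono) auto
    finally show ?case using pos unfolding q_def by (simp add: field_simps)
  qed
  ultimately have "h \<le> h / 2" by (intro tendsto_upperbound) auto
  then show False using h by simp
qed

end

section \<open>Minimal systems and hitting sets\<close>

lemma G_system_continuous:
  assumes "G_system G act" "g \<in> carrier G"
  shows "continuous_on UNIV (act g)"
proof -
  have "continuous_map euclidean (prod_topology (discrete_topology (carrier G)) euclidean)
      (\<lambda>x. (g, x))"
    using assms(2) by (intro continuous_map_pairedI) auto
  from continuous_map_compose[OF this]
  have "continuous_map euclidean euclidean ((\<lambda>(g, x). act g x) \<circ> (\<lambda>x. (g, x)))"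
    using assms(1) unfolding G_system_def by blast
  then show ?thesis by (simp add: o_def)
qed

lemma minimal_system_finite_translates_cover:
  fixes G (structure) and act :: "'g \<Rightarrow> 'x::metric_space \<Rightarrow> 'x"
  assumes "G_system G act" "minimal_system G act" "open U" "U \<noteq> {}"
  shows "\<exists>H. finite H \<and> H \<subseteq> carrier G \<and> (\<Union>g\<in>H. act (inv g) -` U) = UNIV"
proof -
  interpret group_action G UNIV act using assms(1) unfolding G_system_def by blast
  interpret group G by (rule group_hom.axioms(1)[OF group_hom])
  have op: "open (act (inv g) -` U)" if "g \<in> carrier G" for g
    using G_system_continuous[OF assms(1), of "inv g"] that assms(3) open_vimage by blast
  have comp: "compact (UNIV :: 'x set)" using assms(1) unfolding G_system_def by blast
  define Y where "Y = - (\<Union>g\<in>carrier G. act (inv g) -` U)"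
  have "compact Y"
  proof -
    have "closed Y" unfolding Y_def using op by (intro closed_Compl open_UN) auto
    then show ?thesis using comp compact_Int_closed[of UNIV Y] by simp
  qed
  moreover have "act g ` Y \<subseteq> Y" if g: "g \<in> carrier G" for g
  proof
    fix y assume "y \<in> act g ` Y"
    then obtain x where x: "x \<in> Y" "y = act g x" by blast
    have "act (inv h) y \<notin> U" if h: "h \<in> carrier G" for h
    proof -
      have "act (inv h) y = act (inv (inv g \<otimes> h)) x"
        using g h x(2) composition_rule[of x "inv h" g] by (simp add: inv_mult_group)
      then show ?thesis using x(1) g h unfolding Y_def by auto
    qed
    then show "y \<in> Y" unfolding Y_def by auto
  qed
  moreover have "Y \<noteq> UNIV"
  proof -
    obtain u where "u \<in> U" using assms(4) by blast
    then have "u \<notin> Y" unfolding Y_def using fun_cong[OF id_eq_one, of u]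
      by (auto intro!: bexI[of _ \<one>])
    then show ?thesis by blast
  qed
  ultimately have "Y = {}" using assms(2) unfolding minimal_system_def by blast
  then have "UNIV \<subseteq> (\<Union>g\<in>carrier G. act (inv g) -` U)" unfolding Y_def by blast
  from compactE_image[OF comp op this] show ?thesis by (metis top.extremum_uniqueI)
qed

text \<open>An infinite exceptional set would contradict topological \<open>K\<close>: for the cover by the complements
  of the translates by \<open>H\<close> of a closed ball in \<open>V\<close>, the \<open>|H|\<close> constant selections serve all its
  finite subsets at once. Taking a closed ball instead of \<open>V\<close> makes these complements open.\<close>

lemma conjugates_of_hitting_set_cofinite:
  fixes G (structure) and act :: "'g \<Rightarrow> 'x::metric_space \<Rightarrow> 'x"
  assumes "amenable G" "G_system G act" "topological_K G act"
    and "open V" "V \<noteq> {}"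
    and H: "finite H" "H \<subseteq> carrier G" "(\<Union>g\<in>H. act (inv g) -` U) = UNIV"
  shows "finite (carrier G -
           (\<Union>g\<in>H. (g <#\<^bsub>G\<^esub> hitting_set G act U V) #> inv g))"
proof (rule ccontr)
  interpret group_action G UNIV act using assms(2) unfolding G_system_def by blast
  interpret group G by (rule group_hom.axioms(1)[OF group_hom])
  define S where "S = carrier G - (\<Union>g\<in>H. (g <#\<^bsub>G\<^esub> hitting_set G act U V) #> inv g)"
  assume "infinite (carrier G - (\<Union>g\<in>H. (g <#\<^bsub>G\<^esub> hitting_set G act U V) #> inv g))"
  then have S: "infinite S" "S \<subseteq> carrier G" unfolding S_def by auto
  have comp: "act (g \<otimes> h) x = act g (act h x)" if "g \<in> carrier G" "h \<in> carrier G" for g h x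
    using composition_rule that by simp
  have can: "act (inv g) (act g x) = x" "act g (act (inv g) x) = x" if "g \<in> carrier G" for g x
    using orbit_sym_aux[of g x] orbit_sym_aux[of "inv g" x] that by auto
  have avoid: "act (inv g) (act s x) \<notin> V"
    if "s \<in> S" "g \<in> H" "act (inv g) x \<in> U" for s g x
  proof
    assume V: "act (inv g) (act s x) \<in> V"
    have sg: "s \<in> carrier G" "g \<in> carrier G" using that S H by auto
    define t where "t = inv g \<otimes> s \<otimes> g"
    have t: "t \<in> carrier G" using sg unfolding t_def by simp
    have "act t (act (inv g) x) = act (inv g) (act s x)"
      using sg unfolding t_def by (simp add: comp can)
    then have "act t (act (inv g) x) \<in> V" using V by simp
    then have "act (inv g) x \<in> act (inv t) ` V"
      using image_inv_eq_vimage[OF refl t, of V] by simp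
    then have "t \<in> hitting_set G act U V"
      unfolding hitting_set_def using t that(3) by blast
    moreover have "g \<otimes> (inv g \<otimes> s) = s"
      using sg by (simp add: m_assoc[symmetric])
    then have "s = g \<otimes> t \<otimes> inv g"
      using sg unfolding t_def by (simp add: m_assoc)
    ultimately have "s \<in> (g <#\<^bsub>G\<^esub> hitting_set G act U V) #> inv g"
      unfolding l_coset_def r_coset_def by auto
    then show False using that(1,2) unfolding S_def by blast
  qed
  obtain v r where vr: "r > 0" "cball v r \<subseteq> V"
    using assms(4,5) open_contains_cball by (metis all_not_in_conv)
  define W where "W = (\<lambda>g. act (inv g) -` (- cball v r))"
  have into: "act s x \<in> W g" if "s \<in> S" "g \<in> H" "act (inv g) x \<in> U" for s g x
    using avoid[OF that] vr(2) unfolding W_def by auto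
  have index: "\<exists>g\<in>H. act (inv g) x \<in> U" for x using H(3) by blast
  have "finite_cover (W ` H)"
  proof -
    obtain s where s: "s \<in> S" using S(1) by fastforce
    have "y \<in> \<Union> (W ` H)" for y
    proof -
      obtain g where g: "g \<in> H" "act (inv g) (act (inv s) y) \<in> U" using index by blast
      have "act s (act (inv s) y) = y" using can(2) s S(2) by blast
      with into[OF s g] g(1) show ?thesis by (intro UnionI[of "W g"]) auto
    qed
    then show ?thesis using H(1) unfolding finite_cover_def by blast
  qed
  moreover have "\<forall>A\<in>W ` H. open A \<and> closure A \<noteq> UNIV"
  proof
    fix A assume "A \<in> W ` H"
    then obtain g where g: "g \<in> carrier G" "A = W g" using H(2) by blast
    have cont: "continuous_on UNIV (act (inv g))"
      using G_system_continuous[OF assms(2)] g(1) by simp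
    have "open A"
      unfolding g(2) W_def using cont by (intro open_vimage) auto
    moreover have "open (act (inv g) -` ball v r)"
      using cont by (intro open_vimage) auto
    moreover have "act (inv g) -` ball v r \<inter> A = {}"
      unfolding g(2) W_def using ball_subset_cball by blast
    ultimately have "open A" "act (inv g) -` ball v r \<inter> closure A = {}"
      by (auto simp: open_Int_closure_eq_empty)
    moreover have "act g v \<in> act (inv g) -` ball v r" using can[OF g(1)] vr(1) by simp
    ultimately show "open A \<and> closure A \<noteq> UNIV" by blast
  qed
  ultimately obtain h where h: "h > 0" "has_h_top G act (W ` H) h"
    using assms(3) unfolding topological_K_def by blast
  have "itineraries_le act (W ` H) F (card H)" if "F \<subseteq> S" for F
    unfolding itineraries_le_def
  proof (intro exI[of _ "(\<lambda>g _. W g) ` H"] conjI allI)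
    show "card ((\<lambda>g _. W g) ` H) \<le> card H" using H(1) by (rule card_image_le)
    fix x
    show "\<exists>s\<in>(\<lambda>g _. W g) ` H. \<forall>f\<in>F. act f x \<in> s f"
    proof -
      obtain g where g: "g \<in> H" "act (inv g) x \<in> U" using index by blast
      then have "\<forall>f\<in>F. act f x \<in> W g" using into that by blast
      then show ?thesis using g(1) by simp blast
    qed
  qed (use H(1) in auto)
  then have "h \<le> 0"
    using entropy_nonpos_if_bounded_along_infinite_set
      [OF refl \<open>finite_cover (W ` H)\<close> assms(1) h(2) S] by blast
  then show False using h(1) by simp
qed

lemma (in comm_group) conjugate_subset:
  assumes "g \<in> carrier G" "N \<subseteq> carrier G"
  shows "(g <#\<^bsub>G\<^esub> N) #> inv g \<subseteq> N"
proof -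
  have "g \<otimes> n \<otimes> inv g = n" if "n \<in> N" for n
    using assms that by (metis inv_solve_right' m_closed m_comm subsetD)
  then show ?thesis unfolding l_coset_def r_coset_def by auto
qed

theorem theorem7p12:
  fixes G :: "('g, 'm) monoid_scheme"
    and act :: "'g \<Rightarrow> 'x::metric_space \<Rightarrow> 'x"
    and U V :: "'x set"
  assumes "group G" and "countable (carrier G)" and "infinite (carrier G)" and "amenable G"
    and "G_system G act"
    and "open U" and "U \<noteq> {}" and "open V" and "V \<noteq> {}"
    and "minimal_system G act" and "topological_K G act"
  shows "(\<exists>(l::nat) (g :: nat \<Rightarrow> 'g). (\<forall>i\<in>{1..l}. g i \<in> carrier G) \<and>
            finite (carrier G -
              (\<Union>i\<in>{1..l}. (g i <#\<^bsub>G\<^esub> hitting_set G act U V) #>\<^bsub>G\<^esub> inv\<^bsub>G\<^esub> (g i))))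
         \<and> (comm_group G \<longrightarrow> strongly_mixing G act)"
proof (intro conjI impI)
  have main: "\<exists>H. finite H \<and> H \<subseteq> carrier G \<and> finite (carrier G -
      (\<Union>g\<in>H. (g <#\<^bsub>G\<^esub> hitting_set G act A B) #>\<^bsub>G\<^esub> inv\<^bsub>G\<^esub> g))"
    if AB: "open A" "A \<noteq> {}" "open B" "B \<noteq> {}" for A B
  proof -
    obtain H where H: "finite H" "H \<subseteq> carrier G" "(\<Union>g\<in>H. act (inv\<^bsub>G\<^esub> g) -` A) = UNIV"
      using minimal_system_finite_translates_cover[OF assms(5,10) AB(1,2)] by blast
    show ?thesis
      using H(1,2) conjugates_of_hitting_set_cofinite[OF assms(4,5,11) AB(3,4) H]
      by (intro exI[of _ H] conjI)
  qed
  obtain H where H: "finite H" "H \<subseteq> carrier G" "finite (carrier G -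
      (\<Union>g\<in>H. (g <#\<^bsub>G\<^esub> hitting_set G act U V) #>\<^bsub>G\<^esub> inv\<^bsub>G\<^esub> g))"
    using main[OF assms(6-9)] by blast
  define l where "l = card H"
  obtain g where "bij_betw g {1..l} H"
    unfolding l_def using ex_bij_betw_nat_finite_1[OF H(1)] by blast
  then have gH: "g ` {1..l} = H" by (rule bij_betw_imp_surj_on)
  have "\<forall>i\<in>{1..l}. g i \<in> carrier G" using H(2) gH by blast
  moreover have "(\<Union>i\<in>{1..l}. (g i <#\<^bsub>G\<^esub> hitting_set G act U V) #>\<^bsub>G\<^esub> inv\<^bsub>G\<^esub> (g i)) =
      (\<Union>h\<in>H. (h <#\<^bsub>G\<^esub> hitting_set G act U V) #>\<^bsub>G\<^esub> inv\<^bsub>G\<^esub> h)"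
    unfolding gH[symmetric] image_image ..
  ultimately show "\<exists>(l::nat) (g :: nat \<Rightarrow> 'g). (\<forall>i\<in>{1..l}. g i \<in> carrier G) \<and>
      finite (carrier G -
        (\<Union>i\<in>{1..l}. (g i <#\<^bsub>G\<^esub> hitting_set G act U V) #>\<^bsub>G\<^esub> inv\<^bsub>G\<^esub> (g i)))"
    using H(3) by (intro exI[of _ l] exI[of _ g]) simp
  assume "comm_group G"
  then interpret comm_group G .
  show "strongly_mixing G act"
    unfolding strongly_mixing_def
  proof (intro allI impI)
    fix A B :: "'x set"
    assume "open A \<and> A \<noteq> {} \<and> open B \<and> B \<noteq> {}"
    then have AB: "open A" "A \<noteq> {}" "open B" "B \<noteq> {}" by auto
    let ?N = "hitting_set G act A B"
    obtain K where K: "K \<subseteq> carrier G"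
        "finite (carrier G - (\<Union>g\<in>K. (g <#\<^bsub>G\<^esub> ?N) #>\<^bsub>G\<^esub> inv\<^bsub>G\<^esub> g))"
      using main[OF AB] by blast
    have "?N \<subseteq> carrier G" unfolding hitting_set_def by blast
    then have "(\<Union>g\<in>K. (g <#\<^bsub>G\<^esub> ?N) #>\<^bsub>G\<^esub> inv\<^bsub>G\<^esub> g) \<subseteq> ?N"
      using K(1) by (intro UN_least conjugate_subset) auto
    then show "finite (carrier G - ?N)"
      using K(2) by (meson Diff_mono finite_subset order_refl)
  qed
qed

end
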